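(* Define $p_1:=0$ and $p_k:=\frac{2\log(1+1/k)}{\log(1+2/(k-1))}$ for integers $k\ge 2$. For $p\in (p_{k-1},p_k]$, define $\tau(p):=k^{1-2/p}\cdot (k-1)$. Then for $p\in(0,1)$ and $\beta>0$, \[ \lim_{n\to\infty}n^{1-2/p}\log \mathcal{Z}_{n,p}(\beta) = \frac{\beta}{2}\tau(p). \]
   Context: For $p>0$ let $\rho_p(x)=c_p e^{-|x|^p/p}$, $x\in\mathbb{R}$, with $c_p=\frac{p^{-1/p}}{2\Gamma(1+1/p)}$. Let $S_{n,p}:=\{\sigma\in\mathbb{R}^n: \frac1n\sum_{i=1}^n|\sigma_i|^p=1\}$ with the uniform probability measure $d_{n,p}\sigma$ (the law of $X/\|X\|_{n,p}$ with $X_1,\dots,X_n$ i.i.d. $\rho_p$, $\|x\|_{n,p}=(\frac1n\sum_i|x_i|^p)^{1/p}$). With $H_n(\sigma)=\frac1n\sum_{i<j}\sigma_i\sigma_j$, the partition function is $\mathcal{Z}_{n,p}(\beta)=\int_{S_{n,p}}\exp(\beta H_n(\sigma))\,d_{n,p}\sigma$. *)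

theory Defs
  imports "HOL-Probability.Probability"
begin

definition c_p :: "real \<Rightarrow> real" where
  "c_p p = p powr (-1/p) / (2 * Gamma (1 + 1/p))"

definition rho_p :: "real \<Rightarrow> real \<Rightarrow> real" where
  "rho_p p x = c_p p * exp (- (\<bar>x\<bar> powr p) / p)"

definition lp_norm :: "nat \<Rightarrow> real \<Rightarrow> (nat \<Rightarrow> real) \<Rightarrow> real" where
  "lp_norm n p x = ((1 / real n) * (\<Sum>i<n. \<bar>x i\<bar> powr p)) powr (1/p)"

definition iid_rho :: "nat \<Rightarrow> real \<Rightarrow> (nat \<Rightarrow> real) measure" where
  "iid_rho n p = PiM {..<n} (\<lambda>_. density lborel (rho_p p))"

definition sphere_normalize :: "nat \<Rightarrow> real \<Rightarrow> (nat \<Rightarrow> real) \<Rightarrow> (nat \<Rightarrow> real)" where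
  "sphere_normalize n p x = restrict (\<lambda>i. x i / lp_norm n p x) {..<n}"

definition unif_sphere :: "nat \<Rightarrow> real \<Rightarrow> (nat \<Rightarrow> real) measure" where
  "unif_sphere n p = distr (iid_rho n p) (PiM {..<n} (\<lambda>_. lborel)) (sphere_normalize n p)"

definition H_n :: "nat \<Rightarrow> (nat \<Rightarrow> real) \<Rightarrow> real" where
  "H_n n \<sigma> = (1 / real n) * (\<Sum>(i,j)\<in>{(i,j). i < j \<and> j < n}. \<sigma> i * \<sigma> j)"

definition Z_np :: "nat \<Rightarrow> real \<Rightarrow> real \<Rightarrow> real" where
  "Z_np n p \<beta> = (\<integral>\<sigma>. exp (\<beta> * H_n n \<sigma>) \<partial>(unif_sphere n p))"

definition p_k :: "nat \<Rightarrow> real" where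
  "p_k k = (if k \<le> 1 then 0
            else 2 * ln (1 + 1 / real k) / ln (1 + 2 / (real k - 1)))"

definition tau :: "real \<Rightarrow> real" where
  "tau p = (let k = (THE k::nat. 2 \<le> k \<and> p_k (k - 1) < p \<and> p \<le> p_k k)
            in real k powr (1 - 2 / p) * (real k - 1))"

end

theory Submission
  imports Defs "HOL-Real_Asymp.Real_Asymp"
begin

text \<open>
  Put $r = 1/p > 1$ and $w_i = |\sigma_i|^p / n$. On the sphere $\sum_i w_i = 1$ and
  $H_n(\sigma) \le n^{2r-1} \sum_{i<j} (w_i w_j)^r$, so the exponent $\beta H_n$ is of order $n^{2r-1} \gg n$
  and the limit is the maximum of the pair energy over probability weights. If two positive weights
  of a maximizer differ, either merging them into one or averaging them does not decrease the energy
  (the latter strictly increases it); hence a maximizer of minimal support is uniform on $k$ points, with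
  energy $k^{1-2r}(k-1)/2$. This sequence in $k$ is unimodal, with its maximum selected by the $p_k$.
  For the lower bound, let $k$ coordinates lie in a unit interval at height $n^{r^2}$, whose
  $p$-th power $n^r$ is far above $n$, and all others in $[0,1]$: this costs only $e^{-O(n^r)}$,
  which is negligible since $r < 2r - 1$.
\<close>

section \<open>Pair sums and a two-point inequality for powers\<close>

lemma pair_sum_eq:
  fixes y :: "nat \<Rightarrow> real"
  shows "(\<Sum>(i,j)\<in>{(i,j). i < j \<and> j < n}. y i * y j)
           = ((\<Sum>i<n. y i)\<^sup>2 - (\<Sum>i<n. (y i)\<^sup>2)) / 2"
proof (induction n)
  case (Suc n)
  have eq: "{(i,j). i < j \<and> j < Suc n} = {(i,j). i < j \<and> j < n} \<union> (\<lambda>i. (i,n)) ` {..<n}"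
    by (auto simp: less_Suc_eq)
  have "finite {(i,j). i < j \<and> j < n}"
    by (rule finite_subset[of _ "{..<n} \<times> {..<n}"]) auto
  then have "(\<Sum>(i,j)\<in>{(i,j). i < j \<and> j < Suc n}. y i * y j)
      = (\<Sum>(i,j)\<in>{(i,j). i < j \<and> j < n}. y i * y j) + (\<Sum>(i,j)\<in>(\<lambda>i. (i,n)) ` {..<n}. y i * y j)"
    unfolding eq by (intro sum.union_disjoint) auto
  also have "(\<Sum>(i,j)\<in>(\<lambda>i. (i,n)) ` {..<n}. y i * y j) = (\<Sum>i<n. y i) * y n"
    by (subst sum.reindex) (auto simp: inj_on_def sum_distrib_right)
  finally show ?case
    using Suc.IH by (simp add: power2_eq_square field_simps)
qed auto

text \<open>The logarithms of both sides, as functions of $r$, agree at $r = 0$ and $r = 1$; the left one is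
  concave and the right one is affine.\<close>

lemma sinh_le_cosh_powr:
  fixes x r :: real
  assumes "x \<ge> 0" "r \<ge> 1"
  shows "sinh ((r + 1) * x) \<le> (2 * cosh x) powr r * sinh x"
proof (cases "x = 0")
  case False
  with assms have x: "x > 0" by simp
  have conc: "concave_on {0<..} (\<lambda>s. ln (sinh (s * x)))"
  proof (rule f''_le0_imp_concave[where f' = "\<lambda>s. x * cosh (s * x) / sinh (s * x)"
        and f'' = "\<lambda>s. - (x / sinh (s * x))\<^sup>2"])
    fix s :: real assume "s \<in> {0<..}"
    then have pos: "sinh (s * x) > 0" using x by simp
    show "((\<lambda>s. ln (sinh (s * x))) has_real_derivative x * cosh (s * x) / sinh (s * x)) (at s)"
      using pos by (auto intro!: derivative_eq_intros)
    have "(cosh (s * x))\<^sup>2 = (sinh (s * x))\<^sup>2 + 1" by (rule cosh_square_eq)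
    then show "((\<lambda>s. x * cosh (s * x) / sinh (s * x)) has_real_derivative - (x / sinh (s * x))\<^sup>2) (at s)"
      using pos
      by (auto intro!: derivative_eq_intros simp: power2_eq_square divide_simps)
         (simp add: algebra_simps)
  qed auto
  \<comment> \<open>The point 2 is the mean of 1 and \<open>r + 1\<close> with weight
    \<open>1/r\<close> on the latter. Solved for the value at \<open>r + 1\<close>, concavity bounds
    it by extrapolating the chord through 1 and 2; the slope of that chord is
    \<open>ln (2 * cosh x)\<close>.\<close>
  have "(1 - 1/r) * ln (sinh (1 * x)) + (1/r) * ln (sinh ((r+1) * x)) \<le> ln (sinh (2 * x))"
  proof -
    have "(1 - 1/r) *\<^sub>R 1 + (1/r) *\<^sub>R (r+1) = 2" using assms by (simp add: field_simps)
    moreover have "0 \<le> 1/r" "1/r \<le> 1" "1 \<in> {0::real<..}" "r + 1 \<in> {0<..}" using assms by auto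
    ultimately show ?thesis using concave_onD[OF conc, of "1/r" 1 "r+1"] by (simp only:)
  qed
  then have "ln (sinh ((r+1) * x)) \<le> r * ln (sinh (2 * x)) - (r - 1) * ln (sinh x)"
    using assms by (simp add: field_simps)
  also have "ln (sinh (2 * x)) = ln (2 * cosh x) + ln (sinh x)"
    using x by (simp add: sinh_double ln_mult)
  finally have "ln (sinh ((r+1) * x)) \<le> ln ((2 * cosh x) powr r * sinh x)"
    using x by (simp add: ln_mult ln_powr algebra_simps)
  then show ?thesis
    using x assms by (subst (asm) ln_le_cancel_iff) auto
qed auto

text \<open>The left-hand side is the value of the right-hand side at $x = 0$.\<close>

lemma cosh_powr_gap_ge:
  fixes x r :: real
  assumes r: "r \<ge> 1"
  shows "4 powr r - 2 * 2 powr r \<le> (2 * cosh x) powr r * ((2 * cosh x) powr r - 2 * cosh (r * x))"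
proof -
  define g where "g x = (2 * cosh x) powr r * ((2 * cosh x) powr r - 2 * cosh (r * x))" for x :: real
  \<comment> \<open>This is the derivative of \<open>g\<close> once the addition theorem has
    collected both \<open>sinh\<close> terms. In this form its sign for nonnegative arguments is
    exactly \<open>sinh_le_cosh_powr\<close>; negative ones follow because \<open>g\<close> is
    even.\<close>
  define g' where "g' x = 4 * r * (2 * cosh x) powr (r - 1) * ((2 * cosh x) powr r * sinh x - sinh ((r + 1) * x))"
    for x :: real
  have "(g has_real_derivative g' x) (at x)" for x
  proof -
    have D: "(2 * cosh x) powr r = (2 * cosh x) powr (r - 1) * (2 * cosh x)"
      using cosh_real_pos[of x] by (simp add: powr_mult_base mult.commute)
    have "sinh ((r + 1) * x) = sinh (r * x) * cosh x + cosh (r * x) * sinh x"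
      by (simp add: distrib_right sinh_add)
    then show ?thesis
      unfolding g_def g'_def
      using cosh_real_pos[of x]
      by (auto intro!: derivative_eq_intros) (simp add: powr_diff, simp add: field_simps)
  qed
  moreover have "g' x \<ge> 0" if "x \<ge> 0" for x
    using sinh_le_cosh_powr[OF that r] r unfolding g'_def by auto
  ultimately have "g 0 \<le> g \<bar>x\<bar>"
    by (intro DERIV_nonneg_imp_nondecreasing[of 0 "\<bar>x\<bar>" g]) auto
  moreover have "g \<bar>x\<bar> = g x" by (cases "x \<ge> 0") (simp_all only: abs_of_nonneg abs_of_neg not_le, simp add: g_def)
  moreover have "(4::real) powr r = 2 powr r * 2 powr r" by (simp flip: powr_mult)
  then have "g 0 = 4 powr r - 2 * 2 powr r" by (simp add: g_def algebra_simps)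
  ultimately show ?thesis by (simp only: g_def[symmetric])
qed

text \<open>This is the previous inequality for $a = g e^x$, $b = g e^{-x}$.\<close>

lemma powr_two_point_ineq:
  fixes a b r :: real
  assumes "a > 0" "b > 0" and r: "r \<ge> 1"
  defines "N \<equiv> (a + b) powr r" and "M \<equiv> ((a + b) / 2) powr r"
  shows "a powr r * b powr r * (N - 2 * M) \<le> M\<^sup>2 * (N - (a powr r + b powr r))"
proof -
  define g where "g = sqrt (a * b)"
  define x where "x = ln (a / b) / 2"
  define D where "D = (2 * cosh x) powr r"
  have g: "g > 0" using assms by (simp add: g_def)
  have a: "a = g * exp x" and b: "b = g * exp (- x)"
  proof -
    have e: "exp x = sqrt (a / b)"
      using assms by (simp add: x_def ln_sqrt[symmetric])
    show "a = g * exp x" "b = g * exp (- x)"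
      unfolding exp_minus e g_def using assms
      by (auto simp: real_sqrt_mult real_sqrt_divide field_simps)
  qed
  have s: "a + b = g * (2 * cosh x)" by (simp add: a b cosh_def field_simps)
  have N: "N = g powr r * D" using g by (simp add: N_def D_def s powr_mult)
  have M: "M = g powr r * D / 2 powr r" using g by (simp add: M_def D_def s powr_mult powr_divide)
  have A: "a powr r + b powr r = g powr r * (2 * cosh (r * x))"
    using g by (simp add: a b powr_mult cosh_def exp_powr_real field_simps)
  have B: "a powr r * b powr r = (g powr r)\<^sup>2"
    using g by (simp add: a b powr_mult exp_powr_real power2_eq_square flip: exp_add)
  define h where "h = g powr r"
  define t where "t = (2::real) powr r"
  have t: "t > 0" "4 powr r = t\<^sup>2" by (auto simp: t_def power2_eq_square simp flip: powr_mult)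
  have "t\<^sup>2 - 2 * t \<le> D * (D - 2 * cosh (r * x))"
    using cosh_powr_gap_ge[OF r, of x] t by (simp add: D_def t_def)
  \<comment> \<open>Both sides of the goal equal this common factor times a side of the hyperbolic
    inequality.\<close>
  moreover have "h^3 * D / t\<^sup>2 \<ge> 0" by (auto simp: D_def h_def)
  ultimately have "h^3 * D / t\<^sup>2 * (t\<^sup>2 - 2 * t) \<le> h^3 * D / t\<^sup>2 * (D * (D - 2 * cosh (r * x)))"
    by (intro mult_left_mono)
  moreover have "h\<^sup>2 * (h * D - 2 * (h * D / t)) = h^3 * D / t\<^sup>2 * (t\<^sup>2 - 2 * t)"
    using t(1) by (simp add: field_simps power2_eq_square power3_eq_cube)
  moreover have "(h * D / t)\<^sup>2 * (h * D - h * (2 * cosh (r * x)))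
      = h^3 * D / t\<^sup>2 * (D * (D - 2 * cosh (r * x)))"
    using t(1) by (simp add: field_simps power2_eq_square power3_eq_cube)
  ultimately show ?thesis
    unfolding A B N M h_def[symmetric] t_def[symmetric] by simp
qed

text \<open>Here \<open>C\<close> stands for the sum of the \<open>r\<close>-th powers of all other
  weights. If merging and averaging both failed, two linear bounds on \<open>C\<close> in opposite
  directions would result; eliminating \<open>C\<close> from them contradicts
  \<open>powr_two_point_ineq\<close>.\<close>

lemma pair_spread_or_merge:
  fixes a b r C :: real
  assumes "a > 0" "b > 0" "a \<noteq> b" and r: "r > 1" and C: "C \<ge> 0"
  shows "C * (a powr r + b powr r) + a powr r * b powr r \<le> C * (a + b) powr r
       \<or> C * (a powr r + b powr r) + a powr r * b powr r
           < C * (2 * ((a + b) / 2) powr r) + (((a + b) / 2) powr r)\<^sup>2"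
proof (rule ccontr)
  define N where "N = (a + b) powr r"
  define M where "M = ((a + b) / 2) powr r"
  define A where "A = a powr r + b powr r"
  define B where "B = a powr r * b powr r"
  assume "\<not> ?thesis"
  then have 1: "C * (N - A) < B" and 2: "M\<^sup>2 - B \<le> C * (A - 2 * M)"
    by (auto simp: A_def B_def M_def N_def algebra_simps)
  have key: "B * (N - 2 * M) \<le> M\<^sup>2 * (N - A)"
    using powr_two_point_ineq[of a b r] assms by (simp add: A_def B_def M_def N_def)
  have B0: "B > 0" using assms by (simp add: B_def)
  have "(a - b)\<^sup>2 > 0" using assms by simp
  then have "a * b < ((a + b) / 2) * ((a + b) / 2)" by (simp add: field_simps power2_eq_square)
  then have "(a * b) powr r < (((a + b) / 2) * ((a + b) / 2)) powr r"
    using assms by (intro powr_less_mono2) auto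
  then have BM: "B < M\<^sup>2"
    using assms by (simp only: B_def M_def powr_mult power2_eq_square)
  have NM: "N > 2 * M"
  proof -
    have "2 < 2 powr r" using powr_less_mono[of 1 r "2::real"] r by simp
    moreover have "M > 0" using assms by (simp add: M_def)
    moreover have "N = 2 powr r * M" using assms by (simp add: N_def M_def powr_divide)
    ultimately show ?thesis by simp
  qed
  \<comment> \<open>All gaps that serve as multipliers below are shown to be positive, so that no
    inequality reverses.\<close>
  have "C * (A - 2 * M) > 0" using 2 BM by simp
  then have AM: "A > 2 * M" using C by (simp add: zero_less_mult_iff)
  have "B * (N - 2 * M) > 0" using B0 NM by simp
  then have "M\<^sup>2 * (N - A) > 0" using key by linarith
  then have NA: "N - A > 0" by (simp add: zero_less_mult_iff)
  \<comment> \<open>The difference of the two sides is that of \<open>key\<close>, since the terms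
    with \<open>A * B\<close> cancel.\<close>
  have "B * (A - 2 * M) \<le> (M\<^sup>2 - B) * (N - A)" using key by (simp add: algebra_simps)
  also have "\<dots> \<le> (C * (A - 2 * M)) * (N - A)" using 2 NA by (intro mult_right_mono) auto
  also have "\<dots> = (C * (N - A)) * (A - 2 * M)" by simp
  also have "\<dots> < B * (A - 2 * M)" using 1 AM by (intro mult_strict_right_mono) auto
  finally show False by simp
qed

subsection \<open>The thresholds\<close>

lemma ln_one_plus_inverse_bounds:
  fixes x :: real
  assumes "x > 0"
  shows "1 / (x + 1) \<le> ln (1 + 1 / x)" "ln (1 + 1 / x) < 1 / x"
proof -
  show "ln (1 + 1 / x) < 1 / x" using assms by (intro ln_add_one_self_less_self) auto
  have "ln (x / (x + 1)) \<le> x / (x + 1) - 1" using assms by (intro ln_le_minus_one) auto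
  also have "ln (x / (x + 1)) = - ln (1 + 1 / x)" using assms by (simp add: ln_div field_simps)
  finally show "1 / (x + 1) \<le> ln (1 + 1 / x)" using assms by (simp add: field_simps)
qed

lemma ln_one_plus_inverse_pos: "x > 0 \<Longrightarrow> ln (1 + 1 / x) > 0" for x :: real
  by (simp add: ln_gt_zero)

text \<open>The numerator of the derivative has the sign of
  \<open>z * ln (1 + 1/z) - (z + 2) * ln (1 + 1/(z + 1))\<close>, where the first product is below 1
  and the second is at least 1.\<close>

lemma ln_ratio_strict_decreasing:
  fixes x y :: real
  assumes "0 < x" "x < y"
  shows "ln (1 + 1 / y) / ln (1 + 1 / (y + 1)) < ln (1 + 1 / x) / ln (1 + 1 / (x + 1))"
proof (rule DERIV_neg_imp_decreasing[OF assms(2)])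
  fix z assume "x \<le> z" "z \<le> y"
  then have z: "z > 0" using assms by simp
  let ?d = "\<lambda>x::real. ln (1 + 1 / x)"
  let ?D = "(- (1 / (z * (z + 1))) * ?d (z + 1) + ?d z * (1 / ((z + 1) * (z + 2)))) / (?d (z + 1))\<^sup>2"
  have d1: "?d (z + 1) > 0" using z by (intro ln_one_plus_inverse_pos) auto
  have dd: "(?d has_real_derivative - (1 / (w * (w + 1)))) (at w)" if "w > 0" for w
  proof -
    have "1 + 1 / w > 0" using that by (auto intro: add_pos_pos)
    then have "(?d has_real_derivative - (1 / (w * w)) / (1 + 1 / w)) (at w)"
      using that by (auto intro!: derivative_eq_intros)
    moreover have "- (1 / (w * w)) / (1 + 1 / w) = - (1 / (w * (w + 1)))"
      using that by (simp add: field_simps)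
    ultimately show ?thesis by (simp only:)
  qed
  have dd1: "((\<lambda>w. ?d (w + 1)) has_real_derivative - (1 / ((z + 1) * (z + 2)))) (at z)"
    using DERIV_shift[of ?d _ z 1] dd[of "z + 1"] z by (simp add: add.assoc)
  have "((\<lambda>z. ?d z / ?d (z + 1)) has_real_derivative ?D) (at z)"
    using DERIV_divide[OF dd[OF z] dd1] d1 by (simp add: power2_eq_square)
  moreover have "?D < 0"
  proof -
    have "z * ?d z < 1" "1 \<le> (z + 2) * ?d (z + 1)"
      using ln_one_plus_inverse_bounds[of z] ln_one_plus_inverse_bounds[of "z + 1"] z
      by (simp_all add: field_simps)
    then have "z * ?d z < (z + 2) * ?d (z + 1)" by linarith
    moreover have "- (1 / (z * (z + 1))) * v + u * (1 / ((z + 1) * (z + 2)))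
        = (z * u - (z + 2) * v) / (z * (z + 1) * (z + 2))" for u v
      using z by (simp add: divide_simps)
    ultimately have "- (1 / (z * (z + 1))) * ?d (z + 1) + ?d z * (1 / ((z + 1) * (z + 2))) < 0"
      using z by (simp add: divide_neg_pos)
    then show ?thesis using d1 by (simp add: divide_neg_pos)
  qed
  ultimately show "\<exists>D. ((\<lambda>z. ?d z / ?d (z + 1)) has_real_derivative D) (at z) \<and> D < 0" by blast
qed

text \<open>The quotient \<open>(k + 1) / (k - 1)\<close> factors through \<open>k\<close>, so the
  denominator becomes a sum of two consecutive increments of \<open>ln\<close>.\<close>

lemma p_k_eq:
  assumes "k \<ge> 2"
  shows "p_k k = 2 * ln (1 + 1 / real k) / (ln (1 + 1 / real k) + ln (1 + 1 / (real k - 1)))"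
proof -
  have "1 + 2 / (real k - 1) = (1 + 1 / real k) * (1 + 1 / (real k - 1))"
    using assms by (simp add: field_simps)
  moreover have "1 + 1 / real k > 0" "1 + 1 / (real k - 1) > 0" using assms by (auto intro: add_pos_pos)
  ultimately show ?thesis using assms by (simp add: p_k_def ln_mult)
qed

lemma two_frac_less:
  fixes a b c :: real
  assumes "a > 0" "b > 0" "c > 0" "a * a < b * c"
  shows "2 * a / (a + b) < 2 * c / (c + a)"
proof -
  have "2 * a * (c + a) < 2 * c * (a + b)" using assms by (simp add: algebra_simps)
  then show ?thesis using assms by (simp add: divide_less_eq pos_less_divide_eq mult.commute)
qed

text \<open>With \<open>d k = ln (1 + 1/k)\<close>, the threshold is
  \<open>2 / (1 + d (k - 1) / d k)\<close> for \<open>k\<close> at least 2, and the ratio in it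
  strictly decreases in \<open>k\<close>. The index 1 is separate because \<open>p_k 1\<close> is 0
  by convention.\<close>

lemma p_k_Suc_less: "k \<ge> 1 \<Longrightarrow> p_k k < p_k (Suc k)"
proof (cases "k = 1")
  case True
  then show ?thesis by (simp add: p_k_def)
next
  case False
  assume "k \<ge> 1"
  with False have k: "k \<ge> 2" by simp
  let ?d = "\<lambda>x::real. ln (1 + 1 / x)"
  have pos: "?d (real k - 1) > 0" "?d (real k) > 0" "?d (real k + 1) > 0"
    using k by (auto intro!: ln_one_plus_inverse_pos)
  have "?d (real k) / ?d (real k + 1) < ?d (real k - 1) / ?d (real k)"
    using ln_ratio_strict_decreasing[of "real k - 1" "real k"] k by simp
  then have "?d (real k) * ?d (real k) < ?d (real k - 1) * ?d (real k + 1)"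
    using pos by (simp add: field_simps)
  with pos have "2 * ?d (real k) / (?d (real k) + ?d (real k - 1))
     < 2 * ?d (real k + 1) / (?d (real k + 1) + ?d (real k))"
    by (intro two_frac_less) auto
  then show ?thesis using k by (simp add: p_k_eq add.commute)
qed

lemma p_k_less: "1 \<le> j \<Longrightarrow> j < k \<Longrightarrow> p_k j < p_k k"
proof (induction k)
  case (Suc k)
  then show ?case using p_k_Suc_less[of k] by (cases "j = k") auto
qed simp

lemma p_k_mono: "1 \<le> j \<Longrightarrow> j \<le> k \<Longrightarrow> p_k j \<le> p_k k"
  using p_k_less[of j k] by (cases "j = k") auto

text \<open>This ensures that the threshold intervals reach every \<open>p\<close> below 1.\<close>

lemma p_k_tendsto: "p_k \<longlonglongrightarrow> 1"
proof -
  have "(\<lambda>k. 2 * ln (1 + 1 / real k) / ln (1 + 2 / (real k - 1))) \<longlonglongrightarrow> 1"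
    by real_asymp
  then show ?thesis
    by (rule Lim_transform_eventually)
       (auto simp: p_k_def intro!: eventually_mono[OF eventually_gt_at_top[of 1]])
qed

text \<open>The value of \<open>pair_energy (1/p)\<close> at the uniform weights on \<open>k\<close>
  points.\<close>

definition plateau :: "real \<Rightarrow> nat \<Rightarrow> real" where
  "plateau p k = real k powr (1 - 2 / p) * (real k - 1)"

text \<open>The origin of the thresholds: the increment of \<open>ln (plateau p k)\<close> in
  \<open>k\<close> is \<open>(1 - 2/p) * d k + d (k - 1)\<close> with
  \<open>d x = ln (1 + 1/x)\<close>, and \<open>p_k k\<close> is the \<open>p\<close> at which it
  vanishes.\<close>

lemma plateau_Suc_le_iff:
  assumes "0 < p" "k \<ge> 2"
  shows "plateau p (Suc k) \<le> plateau p k \<longleftrightarrow> p \<le> p_k k"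
proof -
  let ?d = "\<lambda>x::real. ln (1 + 1 / x)"
  have k: "real k \<ge> 2" using assms by simp
  have pos: "?d (real k - 1) > 0" "?d (real k) > 0"
    using k by (auto intro!: ln_one_plus_inverse_pos)
  have ln_pl: "ln (plateau p j) = (1 - 2 / p) * ln (real j) + ln (real j - 1)" "plateau p j > 0" if "j \<ge> 2" for j
    using that by (auto simp: plateau_def ln_mult)
  have "plateau p (Suc k) \<le> plateau p k \<longleftrightarrow> ln (plateau p (Suc k)) \<le> ln (plateau p k)"
    using ln_pl(2)[of k] ln_pl(2)[of "Suc k"] assms by simp
  also have "\<dots> \<longleftrightarrow> (1 - 2 / p) * ?d (real k) + ?d (real k - 1) \<le> 0"
  proof -
    have "?d (real k) = ln (real (Suc k)) - ln (real k)" "?d (real k - 1) = ln (real k) - ln (real k - 1)"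
      using k by (simp_all add: add_divide_eq_iff ln_div add.commute)
    then have "(1 - 2 / p) * ?d (real k) + ?d (real k - 1) = ln (plateau p (Suc k)) - ln (plateau p k)"
      unfolding ln_pl(1)[OF assms(2)] ln_pl(1)[OF le_SucI[OF assms(2)]]
      by (simp only:) (simp add: algebra_simps)
    then show ?thesis by linarith
  qed
  also have "\<dots> \<longleftrightarrow> p * (?d (real k) + ?d (real k - 1)) \<le> 2 * ?d (real k)"
    using assms by (simp add: field_simps)
  also have "\<dots> \<longleftrightarrow> p \<le> p_k k"
    using pos assms by (simp add: p_k_eq pos_le_divide_eq)
  finally show ?thesis .
qed

lemma plateau_le_max:
  assumes p: "0 < p" and k: "2 \<le> k" "p_k (k - 1) < p" "p \<le> p_k k" and j: "1 \<le> j"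
  shows "plateau p j \<le> plateau p k"
proof (cases "j \<le> k")
  case True
  then show ?thesis using j
  proof (induction j rule: inc_induct)
    case (step i)
    show ?case
    \<comment> \<open>The comparison criterion starts at index 2; at index 1 the plateau value is
      simply 0.\<close>
    proof (cases "i = 1")
      case True
      then show ?thesis using k by (simp add: plateau_def)
    next
      case False
      with step have i: "i \<ge> 2" by simp
      have "p_k i \<le> p_k (k - 1)" using step i by (intro p_k_mono) auto
      then have "plateau p i \<le> plateau p (Suc i)" using plateau_Suc_le_iff[OF p i] k by force
      then show ?thesis using step by force
    qed
  qed simp
next
  case False
  then have "k \<le> j" by simp
  then show ?thesis
  proof (induction j rule: dec_induct)
    case (step i)
    have "p \<le> p_k i" using p_k_mono[of k i] step k by auto
    then show ?case using plateau_Suc_le_iff[OF p, of i] step k by force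
  qed simp
qed

text \<open>Since the thresholds increase from 0 to the limit 1, exactly one interval contains
  \<open>p\<close>; this makes the description in \<open>tau\<close> meaningful, and unimodality
  identifies its value as the maximum.\<close>

lemma tau_eq_max_plateau:
  assumes "0 < p" "p < 1"
  obtains k where "2 \<le> k" "tau p = plateau p k" "\<And>j. 1 \<le> j \<Longrightarrow> plateau p j \<le> tau p"
proof -
  have "eventually (\<lambda>k. p < p_k k) sequentially"
    using order_tendstoD(1)[OF p_k_tendsto] assms by auto
  then obtain K where K: "p < p_k K" by (auto simp: eventually_sequentially)
  define k where "k = (LEAST k. p \<le> p_k k)"
  have k1: "p \<le> p_k k" unfolding k_def by (rule LeastI[of _ K]) (use K in auto)
  \<comment> \<open>Both \<open>p_k 0\<close> and \<open>p_k 1\<close> are 0, hence below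
    \<open>p\<close>.\<close>
  have k0: "k \<ge> 2" using k1 assms by (auto simp: p_k_def split: if_splits)
  have k2: "p_k (k - 1) < p" using not_less_Least[of "k - 1" "\<lambda>k. p \<le> p_k k"] k0
    by (auto simp: k_def[symmetric])
  have "(THE k. 2 \<le> k \<and> p_k (k - 1) < p \<and> p \<le> p_k k) = k"
  proof (rule the_equality)
    fix j assume j: "2 \<le> j \<and> p_k (j - 1) < p \<and> p \<le> p_k j"
    have "\<not> j < k" using p_k_mono[of j "k - 1"] j k2 by force
    moreover have "\<not> k < j" using p_k_mono[of k "j - 1"] j k0 k1 by force
    ultimately show "j = k" by simp
  qed (use k0 k1 k2 in auto)
  then have "tau p = plateau p k" by (simp add: tau_def plateau_def Let_def)
  with that[of k] plateau_le_max[OF assms(1) k0 k2 k1] k0 show ?thesis by auto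
qed

subsection \<open>Maximizing the pair energy\<close>

text \<open>Twice the sum of \<open>(x i * x j) powr r\<close> over unordered pairs (for nonnegative
  \<open>x\<close>), in a form that requires no order on the index type.\<close>

definition pair_energy :: "real \<Rightarrow> 'a set \<Rightarrow> ('a \<Rightarrow> real) \<Rightarrow> real" where
  "pair_energy r A x = (\<Sum>i\<in>A. x i powr r)\<^sup>2 - (\<Sum>i\<in>A. (x i powr r)\<^sup>2)"

text \<open>The probability simplex on \<open>A\<close>. Vanishing outside \<open>A\<close> makes it
  a compact subset of the full function space.\<close>

definition weights :: "'a set \<Rightarrow> ('a \<Rightarrow> real) set" where
  "weights A = {x. (\<forall>i\<in>A. 0 \<le> x i) \<and> (\<forall>i. i \<notin> A \<longrightarrow> x i = 0) \<and> (\<Sum>i\<in>A. x i) = 1}"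

lemma sum_upd_two:
  fixes h :: "real \<Rightarrow> real"
  assumes "finite A" "i \<in> A" "j \<in> A" "i \<noteq> j"
  shows "(\<Sum>l\<in>A. h ((x(i := a, j := b)) l)) = h a + h b + (\<Sum>l\<in>A - {i,j}. h (x l))"
proof -
  have "(\<Sum>l\<in>A. h ((x(i := a, j := b)) l))
      = h a + (h b + (\<Sum>l\<in>A - {i} - {j}. h ((x(i := a, j := b)) l)))"
    using assms by (simp add: sum.remove[of A i] sum.remove[of "A - {i}" j])
  also have "(\<Sum>l\<in>A - {i} - {j}. h ((x(i := a, j := b)) l)) = (\<Sum>l\<in>A - {i,j}. h (x l))"
    by (intro sum.cong) auto
  finally show ?thesis by (simp only: add.assoc)
qed

text \<open>Isolates the dependence on two weights in the form treated by
  \<open>pair_spread_or_merge\<close>.\<close>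

lemma pair_energy_upd_two:
  assumes "finite A" "i \<in> A" "j \<in> A" "i \<noteq> j"
  shows "pair_energy r A (x(i := a, j := b)) = pair_energy r (A - {i,j}) x
    + 2 * ((\<Sum>l\<in>A - {i,j}. x l powr r) * (a powr r + b powr r) + a powr r * b powr r)"
  unfolding pair_energy_def
    sum_upd_two[OF assms, where h = "\<lambda>t. t powr r"] sum_upd_two[OF assms, where h = "\<lambda>t. (t powr r)\<^sup>2"]
  by (simp add: power2_eq_square algebra_simps)

lemma weights_upd_two:
  assumes "finite A" "i \<in> A" "j \<in> A" "i \<noteq> j" "x \<in> weights A"
    and "0 \<le> a" "0 \<le> b" "a + b = x i + x j"
  shows "x(i := a, j := b) \<in> weights A"
proof -
  have "(\<Sum>l\<in>A. (x(i := a, j := b)) l) = (\<Sum>l\<in>A. (x(i := x i, j := x j)) l)"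
    using sum_upd_two[OF assms(1-4), where h = "\<lambda>t. t"] assms(8) by metis
  then show ?thesis using assms by (auto simp: weights_def)
qed

text \<open>A closed subset of a product of compact intervals, which is compact by
  Tychonoff.\<close>

lemma compact_weights:
  assumes "finite A"
  shows "compact (weights A)"
proof -
  let ?P = "PiE UNIV (\<lambda>i. if i \<in> A then {0..1::real} else {0})"
  have "compactin (product_topology (\<lambda>_. euclidean) UNIV) ?P"
    by (subst compactin_PiE) (auto simp: compactin_euclidean_iff)
  then have "compact ?P" by (simp add: euclidean_product_topology flip: compactin_euclidean_iff)
  moreover have "closed {x::'a \<Rightarrow> real. (\<Sum>i\<in>A. x i) = 1}"
    by (intro closed_Collect_eq continuous_intros continuous_on_product_coordinates)
  ultimately have "compact (?P \<inter> {x. (\<Sum>i\<in>A. x i) = 1})" by (rule compact_Int_closed)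
  also have "?P \<inter> {x. (\<Sum>i\<in>A. x i) = 1} = weights A"
  proof -
    have "x i \<le> 1" if "x \<in> weights A" "i \<in> A" for x i
      using that member_le_sum[of i A x] assms by (auto simp: weights_def)
    then show ?thesis by (auto simp: weights_def PiE_iff split: if_splits)
  qed
  finally show ?thesis .
qed

lemma pair_energy_attains_max:
  assumes "finite A" "A \<noteq> {}" "r > 0"
  shows "\<exists>x\<in>weights A. \<forall>y\<in>weights A. pair_energy r A y \<le> pair_energy r A x"
proof (rule continuous_attains_sup)
  obtain i where "i \<in> A" using assms by auto
  then have "(\<lambda>j. if j = i then 1 else 0) \<in> weights A" using assms by (auto simp: weights_def)
  then show "weights A \<noteq> {}" by auto
  show "continuous_on (weights A) (pair_energy r A)"
    unfolding pair_energy_def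
    using assms
    by (intro continuous_intros continuous_on_powr' continuous_on_subset[OF continuous_on_product_coordinates])
       (auto simp: weights_def)
qed (rule compact_weights[OF assms(1)])

text \<open>Among the maximizers, one with the fewest nonzero weights is taken. For two unequal
  positive weights, a merge that loses nothing would contradict minimality, and a strict gain by
  averaging would contradict maximality.\<close>

lemma pair_energy_le_flat:
  assumes A: "finite A" and r: "r > 1" and w: "w \<in> weights A"
  shows "\<exists>k\<ge>1. pair_energy r A w \<le> real k powr (1 - 2 * r) * (real k - 1)"
proof -
  define S where "S = {x \<in> weights A. \<forall>y\<in>weights A. pair_energy r A y \<le> pair_energy r A x}"
  define supp where "supp x = {i \<in> A. x i \<noteq> 0}" for x :: "'a \<Rightarrow> real"
  have "A \<noteq> {}" using w by (auto simp: weights_def)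
  then have "\<exists>x. x \<in> S" using pair_energy_attains_max[OF A, of r] r by (auto simp: S_def)
  then obtain x where x: "x \<in> S" and least: "\<And>y. y \<in> S \<Longrightarrow> card (supp x) \<le> card (supp y)"
    using ex_has_least_nat[of "\<lambda>x. x \<in> S" _ "\<lambda>x. card (supp x)"] by blast
  have xw: "x \<in> weights A" and xmax: "\<And>y. y \<in> weights A \<Longrightarrow> pair_energy r A y \<le> pair_energy r A x"
    using x by (auto simp: S_def)
  have eq: "x i = x j" if ij: "i \<in> supp x" "j \<in> supp x" for i j
  proof (rule ccontr)
    assume ne: "x i \<noteq> x j"
    define C where "C = (\<Sum>l\<in>A - {i,j}. x l powr r)"
    have pos: "x i > 0" "x j > 0" and iA: "i \<in> A" "j \<in> A" "i \<noteq> j"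
      using ij xw ne by (auto simp: supp_def weights_def less_le)
    have E: "pair_energy r A (x(i := a, j := b)) = pair_energy r (A - {i,j}) x
        + 2 * (C * (a powr r + b powr r) + a powr r * b powr r)" for a b
      unfolding C_def using A iA by (rule pair_energy_upd_two)
    have Ex: "pair_energy r A x = pair_energy r (A - {i,j}) x
        + 2 * (C * (x i powr r + x j powr r) + x i powr r * x j powr r)"
      using E[of "x i" "x j"] by simp
    have "C \<ge> 0" unfolding C_def by (intro sum_nonneg) auto
    from pair_spread_or_merge[OF pos ne r this] show False
    proof
      let ?y = "x(i := x i + x j, j := 0)"
      assume "C * (x i powr r + x j powr r) + x i powr r * x j powr r \<le> C * (x i + x j) powr r"
      then have "pair_energy r A x \<le> pair_energy r A ?y"
        unfolding E Ex using r by simp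
      moreover have "?y \<in> weights A" using A iA xw pos by (intro weights_upd_two) auto
      ultimately have "?y \<in> S" using xmax by (force simp: S_def)
      then have "card (supp x) \<le> card (supp ?y)" by (rule least)
      moreover have "supp ?y \<subset> supp x" using iA pos by (auto simp: supp_def split: if_splits)
      then have "card (supp ?y) < card (supp x)"
        using A by (intro psubset_card_mono) (auto simp: supp_def)
      ultimately show False by simp
    next
      let ?m = "(x i + x j) / 2"
      let ?y = "x(i := ?m, j := ?m)"
      assume "C * (x i powr r + x j powr r) + x i powr r * x j powr r
        < C * (2 * ?m powr r) + (?m powr r)\<^sup>2"
      then have "pair_energy r A x < pair_energy r A ?y"
        unfolding E Ex by (simp add: power2_eq_square)
      moreover have "?y \<in> weights A" using A iA xw pos by (intro weights_upd_two) auto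
      ultimately show False using xmax by force
    qed
  qed
  define k where "k = card (supp x)"
  have fin: "finite (supp x)" using A by (simp add: supp_def)
  have sum1: "(\<Sum>i\<in>supp x. x i) = 1"
    using xw A by (subst sum.mono_neutral_left[of A]) (auto simp: weights_def supp_def)
  then have "supp x \<noteq> {}" by auto
  then obtain i0 where i0: "i0 \<in> supp x" by auto
  have k: "k \<ge> 1" using fin i0 by (auto simp: k_def Suc_le_eq card_gt_0_iff)
  have val: "x i = 1 / real k" if "i \<in> supp x" for i
  proof -
    have "(\<Sum>j\<in>supp x. x j) = (\<Sum>j\<in>supp x. x i)" using that by (intro sum.cong refl eq)
    then show ?thesis using sum1 k by (simp add: k_def field_simps)
  qed
  \<comment> \<open>Applied to \<open>t powr r\<close> and to its square, both of which vanish at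
    0.\<close>
  have reduce: "(\<Sum>i\<in>A. h (x i)) = real k * h (1 / real k)" if "h 0 = 0" for h :: "real \<Rightarrow> real"
  proof -
    have "(\<Sum>i\<in>A. h (x i)) = (\<Sum>i\<in>supp x. h (x i))"
      using A that by (intro sum.mono_neutral_right) (auto simp: supp_def)
    also have "\<dots> = (\<Sum>i\<in>supp x. h (1 / real k))" using val by (intro sum.cong) auto
    finally show ?thesis by (simp add: k_def)
  qed
  have "pair_energy r A x = (real k * (1 / real k) powr r)\<^sup>2 - real k * ((1 / real k) powr r)\<^sup>2"
  proof -
    have "(\<Sum>i\<in>A. x i powr r) = real k * (1 / real k) powr r"
      by (rule reduce) simp
    moreover have "(\<Sum>i\<in>A. (x i powr r)\<^sup>2) = real k * ((1 / real k) powr r)\<^sup>2"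
      by (rule reduce[of "\<lambda>t. (t powr r)\<^sup>2"]) simp
    ultimately show ?thesis by (simp only: pair_energy_def)
  qed
  also have "\<dots> = real k powr (1 - 2 * r) * (real k - 1)"
  proof -
    have "real k powr (1 - 2 * r) = real k * ((1 / real k) powr r)\<^sup>2"
    proof -
      have "real k powr (1 - 2 * r) = real k / (real k powr r * real k powr r)"
        using k powr_diff[of "real k" 1 "r + r"] by (simp only: mult_2 powr_add) simp
      then show ?thesis by (simp add: powr_divide power2_eq_square)
    qed
    moreover have "(K * c)\<^sup>2 - K * c\<^sup>2 = (K * c\<^sup>2) * (K - 1)" for K c :: real
      by (simp add: power2_eq_square algebra_simps)
    ultimately show ?thesis by (simp only:)
  qed
  finally show ?thesis using k xmax[OF w] by auto
qed

section \<open>Bounds for the energy of normalized vectors\<close>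

lemma powr_add_one_le:
  fixes a p :: real
  assumes "0 \<le> a" "0 < p" "p \<le> 1"
  shows "(a + 1) powr p \<le> a powr p + 1"
proof -
  have le: "t \<le> t powr p" if "0 \<le> t" "t \<le> 1" for t :: real
    using powr_mono'[of p 1 t] that assms by (cases "t = 0") auto
  \<comment> \<open>Two numbers in the unit interval with sum 1 do not decrease under the power
    \<open>p\<close>, so the sum of their powers is at least 1.\<close>
  have "1 = a / (a + 1) + 1 / (a + 1)" using assms by (simp add: field_simps)
  also have "\<dots> \<le> (a / (a + 1)) powr p + (1 / (a + 1)) powr p"
    using assms by (intro add_mono le) auto
  also have "\<dots> = (a powr p + 1) / (a + 1) powr p"
    using assms by (simp add: powr_divide add_divide_distrib)
  finally show ?thesis using assms by (simp add: field_simps)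
qed

lemma H_n_eq: "H_n n y = ((\<Sum>i<n. y i)\<^sup>2 - (\<Sum>i<n. (y i)\<^sup>2)) / 2 / real n"
  unfolding H_n_def pair_sum_eq by simp

lemma H_n_mono_abs: "H_n n y \<le> H_n n (\<lambda>i. \<bar>y i\<bar>)"
  unfolding H_n_def
  by (intro mult_left_mono sum_mono) (auto simp flip: abs_mult)

lemma H_sphere_le:
  assumes p: "0 < p" "p < 1"
  shows "H_n n (sphere_normalize n p x) \<le> real n powr (2 / p - 1) * (tau p / 2)"
proof -
  define r where "r = 1 / p"
  have r: "r > 1" using p by (simp add: r_def)
  have tau: "plateau p j \<le> tau p" if "1 \<le> j" for j
    using tau_eq_max_plateau[OF p] that by metis
  have tau0: "tau p \<ge> 0" using tau[of 1] by (simp add: plateau_def)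
  define \<sigma> where "\<sigma> = sphere_normalize n p x"
  define T where "T = (\<Sum>i<n. \<bar>x i\<bar> powr p)"
  have T0: "T \<ge> 0" unfolding T_def by (intro sum_nonneg) auto
  have N: "lp_norm n p x = (T / real n) powr r" by (simp add: lp_norm_def T_def r_def)
  show ?thesis
  \<comment> \<open>In the degenerate case the norm is 0, and division by zero returns 0, so the
    normalized coordinates and the energy vanish.\<close>
  proof (cases "T = 0 \<or> n = 0")
    case True
    then have "H_n n \<sigma> = 0" by (auto simp: H_n_eq \<sigma>_def sphere_normalize_def N)
    then show ?thesis using tau0 by (simp add: \<sigma>_def)
  next
    case False
    then have T: "T > 0" and n: "n > 0" using T0 by auto
    define w where "w i = (if i < n then \<bar>x i\<bar> powr p / T else 0)" for i
    have "(\<Sum>i<n. w i) = (\<Sum>i<n. \<bar>x i\<bar> powr p) / T" by (simp add: w_def sum_divide_distrib)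
    then have "w \<in> weights {..<n}" using T by (auto simp: weights_def w_def T_def[symmetric])
    from pair_energy_le_flat[OF _ r this]
    obtain j where "j \<ge> 1" "pair_energy r {..<n} w \<le> plateau p j" by (auto simp: plateau_def r_def)
    then have E: "pair_energy r {..<n} w \<le> tau p" using tau[of j] by simp
    have \<sigma>: "\<bar>\<sigma> i\<bar> = real n powr r * w i powr r" if "i < n" for i
    proof -
      have "w i powr r = \<bar>x i\<bar> / T powr r"
        using that p T by (simp add: w_def powr_divide powr_powr r_def)
      moreover have "\<bar>\<sigma> i\<bar> = \<bar>x i\<bar> / lp_norm n p x"
        using that by (simp add: \<sigma>_def sphere_normalize_def abs_divide N)
      ultimately show ?thesis using T n by (simp add: N powr_divide)
    qed
    have "H_n n \<sigma> \<le> H_n n (\<lambda>i. \<bar>\<sigma> i\<bar>)" by (rule H_n_mono_abs)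
    also have "\<dots> = H_n n (\<lambda>i. real n powr r * w i powr r)"
      using \<sigma> by (simp add: H_n_eq flip: sum_distrib_left)
    also have "\<dots> = (real n powr r)\<^sup>2 / real n * (pair_energy r {..<n} w / 2)"
    proof -
      have "(\<Sum>i<n. real n powr r * w i powr r) = real n powr r * (\<Sum>i<n. w i powr r)"
        "(\<Sum>i<n. (real n powr r * w i powr r)\<^sup>2) = (real n powr r)\<^sup>2 * (\<Sum>i<n. (w i powr r)\<^sup>2)"
        by (simp_all add: sum_distrib_left power_mult_distrib)
      then show ?thesis
        unfolding H_n_eq pair_energy_def
        by (simp only: power_mult_distrib right_diff_distrib[symmetric]) simp
    qed
    also have "(real n powr r)\<^sup>2 / real n = real n powr (2 / p - 1)"
      using n by (simp add: powr_diff r_def power2_eq_square flip: powr_add)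
    also have "\<dots> * (pair_energy r {..<n} w / 2) \<le> real n powr (2 / p - 1) * (tau p / 2)"
      using E by (intro mult_left_mono) auto
    finally show ?thesis by (simp add: \<sigma>_def)
  qed
qed

text \<open>The \<open>p\<close>-th power of each of the first \<open>k\<close> entries is
  \<open>L * n\<close>. The factor \<open>L\<close> measures how far it exceeds the total of at most
  \<open>n\<close> that the unit side lengths can add.\<close>

definition cube_corner :: "nat \<Rightarrow> real \<Rightarrow> nat \<Rightarrow> real \<Rightarrow> nat \<Rightarrow> real" where
  "cube_corner n p k L i = (if i < k then (L * real n) powr (1 / p) else 0)"

lemma cube_corner_nonneg: "cube_corner n p k L i \<ge> 0"
  by (simp add: cube_corner_def)

lemma abs_powr_le_cube_corner:
  assumes "0 < p" "p < 1" "L > 0" "t \<in> {cube_corner n p k L i..cube_corner n p k L i + 1}"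
  shows "\<bar>t\<bar> powr p \<le> (if i < k then L * real n else 0) + 1"
proof -
  let ?a = "cube_corner n p k L i"
  have "\<bar>t\<bar> powr p \<le> (?a + 1) powr p"
    using assms cube_corner_nonneg[of n p k L i] by (intro powr_mono2) auto
  also have "\<dots> \<le> ?a powr p + 1"
    using assms cube_corner_nonneg[of n p k L i] by (intro powr_add_one_le) auto
  also have "?a powr p = (if i < k then L * real n else 0)"
    using assms by (simp add: cube_corner_def powr_powr)
  finally show ?thesis .
qed

lemma sum_cube_bounds:
  fixes M :: real
  assumes "k \<le> n"
  shows "(\<Sum>i<n. (if i < k then M else 0) + 1) = real k * M + real n"
proof -
  have "{..<n} \<inter> {i. i < k} = {..<k}" using assms by auto
  then show ?thesis by (simp add: sum.distrib sum.If_cases)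
qed

text \<open>The sum of all \<open>p\<close>-th powers is at most \<open>(k * L + 1) * n\<close>, so
  each of the first \<open>k\<close> coordinates carries at least the share
  \<open>L / (k * L + 1)\<close>, which is close to \<open>1/k\<close> for large \<open>L\<close>.
  All coordinates are nonnegative, so the other pairs may be dropped.\<close>

lemma H_sphere_ge_on_cube:
  assumes p: "0 < p" "p < 1" and L: "L > 0" and k: "1 \<le> k" "k \<le> n"
    and x: "\<And>i. i < n \<Longrightarrow> x i \<in> {cube_corner n p k L i..cube_corner n p k L i + 1}"
  shows "real n powr (2 / p - 1) * ((L / (real k * L + 1)) powr (2 / p) * (real k * (real k - 1) / 2))
     \<le> H_n n (sphere_normalize n p x)"
proof -
  define r where "r = 1 / p"
  define \<sigma> where "\<sigma> = sphere_normalize n p x"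
  define T where "T = (\<Sum>i<n. \<bar>x i\<bar> powr p)"
  have N: "lp_norm n p x = (T / real n) powr r" by (simp add: lp_norm_def T_def r_def)
  have n: "n > 0" using k by simp
  have "0 < \<bar>x 0\<bar> powr p"
    using x[of 0] k n L by (auto simp: cube_corner_def)
  also have "\<dots> \<le> T" unfolding T_def using n by (intro member_le_sum) auto
  finally have T0: "T > 0" .
  have "T \<le> (\<Sum>i<n. (if i < k then L * real n else 0) + 1)"
    unfolding T_def using abs_powr_le_cube_corner[OF p L x] by (intro sum_mono) auto
  also have "\<dots> = (real k * L + 1) * real n" using k sum_cube_bounds[of k n "L * real n"] by (simp only:) (simp add: algebra_simps)
  finally have "T / real n \<le> real k * L + 1" using n by (simp add: field_simps)
  then have NU: "lp_norm n p x \<le> (real k * L + 1) powr r"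
    unfolding N using T0 p by (intro powr_mono2) (auto simp: r_def)
  have N0: "lp_norm n p x > 0" unfolding N using T0 n by simp
  define s where "s = real n powr r * (L / (real k * L + 1)) powr r"
  have s0: "s \<ge> 0" by (simp add: s_def)
  have \<sigma>0: "\<sigma> i \<ge> 0" if "i < n" for i
    using x[OF that] cube_corner_nonneg[of n p k L i] N0 that by (auto simp: \<sigma>_def sphere_normalize_def)
  have \<sigma>s: "s \<le> \<sigma> i" if "i < k" for i
  proof -
    have "0 \<le> x i" using x[of i] cube_corner_nonneg[of n p k L i] that k by auto
    have "s = (L * real n) powr r / (real k * L + 1) powr r"
      using L n by (simp add: s_def powr_divide powr_mult)
    also have "\<dots> \<le> x i / lp_norm n p x"
      using x[of i] \<open>0 \<le> x i\<close> that k NU N0 by (intro frac_le) (auto simp: cube_corner_def r_def)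
    finally show ?thesis using that k by (simp add: \<sigma>_def sphere_normalize_def)
  qed
  have fin: "finite {(i,j). i < j \<and> j < n}"
    by (rule finite_subset[of _ "{..<n} \<times> {..<n}"]) auto
  have "s\<^sup>2 * (real k * (real k - 1) / 2) = (\<Sum>(i,j)\<in>{(i,j). i < j \<and> j < k}. s * s)"
    unfolding pair_sum_eq[of "\<lambda>_. s" k] by (simp add: power_mult_distrib) (simp add: power2_eq_square field_simps)
  also have "\<dots> \<le> (\<Sum>(i,j)\<in>{(i,j). i < j \<and> j < k}. \<sigma> i * \<sigma> j)"
  proof (rule sum_mono, clarify)
    fix i j assume "i < j" "j < k"
    then show "s * s \<le> \<sigma> i * \<sigma> j"
      using \<sigma>s[of i] \<sigma>s[of j] s0 by (intro mult_mono) auto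
  qed
  also have "\<dots> \<le> (\<Sum>(i,j)\<in>{(i,j). i < j \<and> j < n}. \<sigma> i * \<sigma> j)"
    using k \<sigma>0 fin by (intro sum_mono2) auto
  finally have "s\<^sup>2 * (real k * (real k - 1) / 2) / real n
      \<le> (\<Sum>(i,j)\<in>{(i,j). i < j \<and> j < n}. \<sigma> i * \<sigma> j) / real n"
    by (rule divide_right_mono) simp
  also have "\<dots> = H_n n \<sigma>" by (simp add: H_n_def)
  finally have "s\<^sup>2 * (real k * (real k - 1) / 2) / real n \<le> H_n n \<sigma>" .
  also have "s\<^sup>2 * (real k * (real k - 1) / 2) / real n =
     real n powr (2 / p - 1) * ((L / (real k * L + 1)) powr (2 / p) * (real k * (real k - 1) / 2))"
  proof -
    have "(t powr r)\<^sup>2 = t powr (2 / p)" for t :: real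
      by (simp add: power2_eq_square r_def flip: powr_add)
    then show ?thesis using n by (simp add: s_def power_mult_distrib powr_diff)
  qed
  finally show ?thesis by (simp add: \<sigma>_def)
qed

subsection \<open>Bounds for the partition function\<close>

lemma c_p_pos: "p > 0 \<Longrightarrow> c_p p > 0"
  by (simp add: c_p_def Gamma_real_pos add_pos_pos)

lemma rho_p_nonneg: "p > 0 \<Longrightarrow> rho_p p x \<ge> 0"
  using c_p_pos[of p] by (simp add: rho_p_def)

lemma borel_measurable_rho_p[measurable]: "rho_p p \<in> borel_measurable borel"
  unfolding rho_p_def by measurable

text \<open>The density is dominated by a multiple of \<open>1 / (1 + x^2)\<close>.\<close>

lemma integrable_rho_p:
  assumes p: "p > 0"
  shows "integrable lborel (rho_p p)"
proof -
  have "((\<lambda>x. exp (- (x powr p) / p) * (1 + x\<^sup>2)) \<longlongrightarrow> 0) at_top"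
    using p by real_asymp
  then have "eventually (\<lambda>x. exp (- (x powr p) / p) * (1 + x\<^sup>2) < 1) at_top"
    by (rule order_tendstoD) simp
  then obtain b where b: "\<And>x. x \<ge> b \<Longrightarrow> exp (- (x powr p) / p) * (1 + x\<^sup>2) < 1"
    by (auto simp: eventually_at_top_linorder)
  \<comment> \<open>Large enough for both ranges: the product is below 1 from \<open>b\<close> on,
    and \<open>1 + x^2\<close> is at most \<open>1 + b^2\<close> otherwise.\<close>
  define B where "B = 1 + b\<^sup>2"
  have bound: "exp (- (\<bar>x\<bar> powr p) / p) * (1 + x\<^sup>2) \<le> B" for x
  proof (cases "\<bar>x\<bar> \<ge> b")
    case True
    then have "exp (- (\<bar>x\<bar> powr p) / p) * (1 + x\<^sup>2) < 1" using b[of "\<bar>x\<bar>"] by simp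
    also have "1 \<le> B" by (simp add: B_def)
    finally show ?thesis by simp
  next
    case False
    then have "x\<^sup>2 \<le> b\<^sup>2" using power_mono[of "\<bar>x\<bar>" b 2] by simp
    moreover have "exp (- (\<bar>x\<bar> powr p) / p) \<le> 1" using p by simp
    ultimately have "exp (- (\<bar>x\<bar> powr p) / p) * (1 + x\<^sup>2) \<le> 1 * B"
      unfolding B_def by (intro mult_mono) auto
    then show ?thesis by simp
  qed
  have "integrable lborel (\<lambda>x::real. inverse (1 + x\<^sup>2))"
    using integrable_inverse_1_plus_square by (simp add: set_integrable_def)
  then have "integrable lborel (\<lambda>x::real. c_p p * B * inverse (1 + x\<^sup>2))" by simp
  then show ?thesis
  proof (rule Bochner_Integration.integrable_bound)
    show "AE x in lborel. norm (rho_p p x) \<le> norm (c_p p * B * inverse (1 + x\<^sup>2))"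
    proof (intro AE_I2)
      fix x :: real
      have "1 + x\<^sup>2 > 0" by (simp add: add_pos_nonneg)
      then have "exp (- (\<bar>x\<bar> powr p) / p) \<le> B * inverse (1 + x\<^sup>2)"
        using bound[of x] by (simp add: field_simps)
      then have "rho_p p x \<le> c_p p * (B * inverse (1 + x\<^sup>2))"
        using c_p_pos[OF p] unfolding rho_p_def by (intro mult_left_mono) auto
      then show "norm (rho_p p x) \<le> norm (c_p p * B * inverse (1 + x\<^sup>2))"
        using rho_p_nonneg[OF p, of x] by (simp add: mult.assoc)
    qed
  qed simp
qed

text \<open>This equals 1, but the limit only needs that it is finite: it enters through
  $n \cdot \ln(\mathrm{mass})$, which is of lower order than $n^{2/p-1}$.\<close>

definition rho_mass :: "real \<Rightarrow> real" where
  "rho_mass p = integral\<^sup>L lborel (rho_p p)"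

lemma emeasure_density_rho_p:
  assumes "p > 0"
  shows "emeasure (density lborel (rho_p p)) UNIV = ennreal (rho_mass p)"
  using assms by (simp add: emeasure_density rho_mass_def nn_integral_eq_integral integrable_rho_p rho_p_nonneg)

lemma finite_measure_density_rho_p: "p > 0 \<Longrightarrow> finite_measure (density lborel (rho_p p))"
  by (intro finite_measureI) (simp add: emeasure_density_rho_p)

lemma product_sigma_finite_rho_p: "p > 0 \<Longrightarrow> product_sigma_finite (\<lambda>_. density lborel (rho_p p))"
  using finite_measure_density_rho_p[of p]
  by (simp add: product_sigma_finite_def finite_measure.axioms(1) finite_measure_def)

lemma emeasure_iid_rho_PiE:
  assumes "p > 0" and "\<And>i. i < n \<Longrightarrow> B i \<in> sets borel"
  shows "emeasure (iid_rho n p) (PiE {..<n} B) = (\<Prod>i<n. emeasure (density lborel (rho_p p)) (B i))"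
proof -
  interpret product_sigma_finite "\<lambda>_::nat. density lborel (rho_p p)"
    by (rule product_sigma_finite_rho_p[OF assms(1)])
  show ?thesis unfolding iid_rho_def using assms(2) by (intro emeasure_PiM) auto
qed

lemma rho_mass_nonneg: "p > 0 \<Longrightarrow> rho_mass p \<ge> 0"
  unfolding rho_mass_def by (intro integral_nonneg_AE AE_I2 rho_p_nonneg)

lemma space_iid_rho: "space (iid_rho n p) = PiE {..<n} (\<lambda>_. UNIV)"
  by (simp add: iid_rho_def space_PiM)

lemma emeasure_space_iid_rho:
  "p > 0 \<Longrightarrow> emeasure (iid_rho n p) (space (iid_rho n p)) = ennreal (rho_mass p ^ n)"
  by (simp add: space_iid_rho emeasure_iid_rho_PiE emeasure_density_rho_p prod_constant
        ennreal_power rho_mass_nonneg)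

text \<open>The interval has length 1, so a pointwise lower bound for the density also bounds its
  mass.\<close>

lemma emeasure_density_rho_p_Icc_ge:
  assumes "p > 0" and "\<And>t. t \<in> {a..a+1} \<Longrightarrow> \<bar>t\<bar> powr p \<le> K"
  shows "ennreal (c_p p * exp (- K / p)) \<le> emeasure (density lborel (rho_p p)) {a..a+1}"
proof -
  have "ennreal (c_p p * exp (- K / p)) = (\<integral>\<^sup>+x. ennreal (c_p p * exp (- K / p)) * indicator {a..a+1} x \<partial>lborel)"
    by (simp add: nn_integral_cmult_indicator)
  also have "\<dots> \<le> (\<integral>\<^sup>+x. ennreal (rho_p p x) * indicator {a..a+1} x \<partial>lborel)"
  proof (intro nn_integral_mono)
    fix x
    show "ennreal (c_p p * exp (- K / p)) * indicator {a..a+1} x \<le> ennreal (rho_p p x) * indicator {a..a+1} x"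
    proof (cases "x \<in> {a..a+1}")
      case True
      then have "c_p p * exp (- K / p) \<le> rho_p p x"
        using assms(2)[OF True] c_p_pos[OF assms(1)] assms(1)
        by (simp add: rho_p_def divide_right_mono)
      then show ?thesis using True by (simp add: ennreal_leI)
    qed simp
  qed
  also have "\<dots> = emeasure (density lborel (rho_p p)) {a..a+1}"
    by (simp add: emeasure_density)
  finally show ?thesis .
qed

definition unit_cube :: "nat \<Rightarrow> real \<Rightarrow> nat \<Rightarrow> real \<Rightarrow> (nat \<Rightarrow> real) set" where
  "unit_cube n p k L = PiE {..<n} (\<lambda>i. {cube_corner n p k L i..cube_corner n p k L i + 1})"

lemma emeasure_unit_cube_ge:
  assumes p: "0 < p" "p < 1" and "L > 0" "k \<le> n"
  shows "ennreal (c_p p ^ n * exp (- (real k * (L * real n) + real n) / p))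
       \<le> emeasure (iid_rho n p) (unit_cube n p k L)"
proof -
  let ?K = "\<lambda>i. (if i < k then L * real n else 0) + 1"
  have "c_p p ^ n * exp (- (real k * (L * real n) + real n) / p) = (\<Prod>i<n. c_p p * exp (- ?K i / p))"
  proof -
    have "(\<Sum>i<n. - ?K i / p) = - (real k * (L * real n) + real n) / p"
      unfolding sum_cube_bounds[OF assms(4), symmetric] sum_negf[symmetric] sum_divide_distrib ..
    then show ?thesis by (simp only: prod.distrib exp_sum[symmetric] finite_lessThan) simp
  qed
  then have "ennreal (c_p p ^ n * exp (- (real k * (L * real n) + real n) / p))
      = (\<Prod>i<n. ennreal (c_p p * exp (- ?K i / p)))"
    using c_p_pos[OF p(1)] by (subst prod_ennreal) auto
  also have "\<dots> \<le> (\<Prod>i<n. emeasure (density lborel (rho_p p))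
                        {cube_corner n p k L i..cube_corner n p k L i + 1})"
    using abs_powr_le_cube_corner[OF p assms(3)]
    by (intro prod_mono_ennreal emeasure_density_rho_p_Icc_ge p) auto
  also have "\<dots> = emeasure (iid_rho n p) (unit_cube n p k L)"
    unfolding unit_cube_def using p by (subst emeasure_iid_rho_PiE) auto
  finally show ?thesis .
qed

lemma measurable_sphere_normalize[measurable]:
  "sphere_normalize n p \<in> measurable (iid_rho n p) (PiM {..<n} (\<lambda>_. lborel))"
proof -
  have [measurable]: "(\<lambda>x. x i) \<in> borel_measurable (iid_rho n p)" if "i < n" for i
    using measurable_component_singleton[of i "{..<n}" "\<lambda>_. density lborel (rho_p p)"] that
    by (simp add: iid_rho_def)
  have [measurable]: "lp_norm n p \<in> borel_measurable (iid_rho n p)"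
    unfolding lp_norm_def by measurable
  show ?thesis
    unfolding sphere_normalize_def by (intro measurable_restrict) measurable
qed

lemma borel_measurable_H_n[measurable]:
  "H_n n \<in> borel_measurable (PiM {..<n} (\<lambda>_. lborel))"
proof -
  have [measurable]: "(\<lambda>x. x i) \<in> borel_measurable (PiM {..<n} (\<lambda>_. lborel :: real measure))" if "i < n" for i
    using measurable_component_singleton[of i "{..<n}" "\<lambda>_. lborel :: real measure"] that by simp
  show ?thesis unfolding H_n_eq by measurable
qed

text \<open>Above, the pointwise energy bound is integrated against the total mass; below, the
  integral is restricted to the cube. The parameter \<open>L\<close> stays free so that it can grow
  with \<open>n\<close>.\<close>

lemma Z_np_bounds:
  assumes p: "0 < p" "p < 1" and \<beta>: "\<beta> > 0" and L: "L > 0" and k: "1 \<le> k" "k \<le> n"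
  shows "Z_np n p \<beta> \<le> rho_mass p ^ n * exp (\<beta> * (real n powr (2 / p - 1) * (tau p / 2)))"
    and "c_p p ^ n * exp (- (real k * (L * real n) + real n) / p)
           * exp (\<beta> * (real n powr (2 / p - 1)
               * ((L / (real k * L + 1)) powr (2 / p) * (real k * (real k - 1) / 2)))) \<le> Z_np n p \<beta>"
proof -
  let ?Q = "iid_rho n p"
  let ?G = "\<lambda>x. exp (\<beta> * H_n n (sphere_normalize n p x))"
  let ?U = "exp (\<beta> * (real n powr (2 / p - 1) * (tau p / 2)))"
  let ?V = "exp (\<beta> * (real n powr (2 / p - 1)
               * ((L / (real k * L + 1)) powr (2 / p) * (real k * (real k - 1) / 2))))"
  let ?A = "unit_cube n p k L"
  interpret finite_measure ?Q by (intro finite_measureI) (simp add: emeasure_space_iid_rho p)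
  have Z: "Z_np n p \<beta> = (\<integral>x. ?G x \<partial>?Q)"
    unfolding Z_np_def unif_sphere_def by (subst integral_distr) measurable
  have GU: "?G x \<le> ?U" for x
    using H_sphere_le[OF p, of n x] \<beta> by simp
  have int: "integrable ?Q ?G"
    by (rule integrable_const_bound[where B = ?U]) (use GU in auto)
  have "(\<integral>x. ?G x \<partial>?Q) \<le> (\<integral>x. ?U \<partial>?Q)"
    using GU int by (intro integral_mono) auto
  also have "\<dots> = rho_mass p ^ n * ?U"
    using p by (simp add: measure_def emeasure_space_iid_rho rho_mass_nonneg)
  finally show "Z_np n p \<beta> \<le> rho_mass p ^ n * ?U" unfolding Z .
  have A: "?A \<in> sets ?Q" unfolding unit_cube_def iid_rho_def by (intro sets_PiM_I_finite) auto
  have GV: "?V \<le> ?G x" if "x \<in> ?A" for x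
  proof -
    have "x i \<in> {cube_corner n p k L i..cube_corner n p k L i + 1}" if "i < n" for i
      using \<open>x \<in> ?A\<close> that by (auto simp: unit_cube_def PiE_iff)
    then show ?thesis using H_sphere_ge_on_cube[OF p L k, of x] \<beta> by simp
  qed
  have "c_p p ^ n * exp (- (real k * (L * real n) + real n) / p) \<le> measure ?Q ?A"
    using emeasure_unit_cube_ge[OF p L k(2)] by (simp add: emeasure_eq_measure)
  then have "c_p p ^ n * exp (- (real k * (L * real n) + real n) / p) * ?V \<le> measure ?Q ?A * ?V"
    by (intro mult_right_mono) auto
  also have "\<dots> = (\<integral>x. indicator ?A x * ?V \<partial>?Q)" using A by simp
  also have "\<dots> \<le> (\<integral>x. ?G x \<partial>?Q)"
  proof (rule integral_mono)
    show "integrable ?Q (\<lambda>x. indicator ?A x * ?V)"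
      using A by (intro integrable_mult_left integrable_real_indicator) (auto simp: less_top[symmetric])
    show "indicator ?A x * ?V \<le> ?G x" for x
      using GV[of x] by (cases "x \<in> ?A") auto
  qed (rule int)
  finally show "c_p p ^ n * exp (- (real k * (L * real n) + real n) / p) * ?V \<le> Z_np n p \<beta>"
    unfolding Z .
qed

section \<open>The limit, by squeezing between the two bounds\<close>

theorem theorem1p5:
  fixes p \<beta> :: real
  assumes "0 < p" and "p < 1" and "0 < \<beta>"
  shows "(\<lambda>n. real n powr (1 - 2 / p) * ln (Z_np n p \<beta>)) \<longlonglongrightarrow> \<beta> / 2 * tau p"
proof -
  note p = assms(1,2)
  obtain k where k: "2 \<le> k" "tau p = plateau p k" using tau_eq_max_plateau[OF p] by metis
  define q where "q = 2 / p"
  have q: "q > 2" using p by (simp add: q_def field_simps)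
  define K where "K = real k"
  have K: "K \<ge> 2" using k by (simp add: K_def)
  \<comment> \<open>As \<open>q > 2\<close>, this tends to infinity, which drives the shares to
    \<open>1/K\<close>. The cost of the cube, after scaling, is of order
    \<open>n powr (1 - q) * L n * n = n powr (1 - q/2)\<close> and still vanishes.\<close>
  define L where "L n = real n powr (q / 2 - 1)" for n
  define c where "c = ln (c_p p)"
  define lower where "lower n = \<beta> * ((L n / (K * L n + 1)) powr q * (K * (K - 1) / 2))
      + real n powr (1 - q) * (real n * c - (K * (L n * real n) + real n) / p)" for n
  define upper where "upper n = real n powr (1 - q) * (real n * ln (rho_mass p)) + \<beta> / 2 * tau p" for n
  have bounds: "lower n \<le> real n powr (1 - q) * ln (Z_np n p \<beta>)
      \<and> real n powr (1 - q) * ln (Z_np n p \<beta>) \<le> upper n" if n: "n \<ge> k" for n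
  proof -
    have n0: "n > 0" "1 \<le> k" using n k by auto
    have L: "L n > 0" using n0 by (simp add: L_def)
    note Z = Z_np_bounds[OF assms L n0(2) n, folded q_def K_def]
    let ?h = "(L n / (K * L n + 1)) powr q * (K * (K - 1) / 2)"
    have cancel: "real n powr (1 - q) * real n powr (q - 1) = 1"
      using n0 by (simp flip: powr_add)
    have Zlow: "0 < c_p p ^ n * exp (- (K * (L n * real n) + real n) / p) * exp (\<beta> * (real n powr (q - 1) * ?h))"
      using c_p_pos[OF p(1)] by simp
    then have Z0: "Z_np n p \<beta> > 0" using Z(2) by linarith
    \<comment> \<open>Positivity of the mass, required for its logarithm, is read off from the two
      bounds on the positive \<open>Z_np n p \<beta>\<close>.\<close>
    then have "rho_mass p ^ n > 0" using Z(1) by (metis exp_gt_zero less_le_trans zero_less_mult_pos2)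
    then have m: "rho_mass p > 0"
      using n0 rho_mass_nonneg[OF p(1)] by (cases "rho_mass p = 0") (auto simp: power_0_left)
    have "ln (Z_np n p \<beta>) \<le> ln (rho_mass p ^ n * exp (\<beta> * (real n powr (q - 1) * (tau p / 2))))"
      using Z(1) Z0 by (intro ln_mono) auto
    also have "\<dots> = real n * ln (rho_mass p) + real n powr (q - 1) * (\<beta> / 2 * tau p)"
      using m by (simp add: ln_mult ln_realpow)
    finally have "real n powr (1 - q) * ln (Z_np n p \<beta>)
       \<le> real n powr (1 - q) * (real n * ln (rho_mass p) + real n powr (q - 1) * (\<beta> / 2 * tau p))"
      by (intro mult_left_mono) auto
    also have "\<dots> = upper n"
      unfolding upper_def using cancel by (simp only: distrib_left mult.assoc[symmetric] mult_1)
    finally have up: "real n powr (1 - q) * ln (Z_np n p \<beta>) \<le> upper n" .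
    have "real n * c - (K * (L n * real n) + real n) / p + real n powr (q - 1) * (\<beta> * ?h)
        = ln (c_p p ^ n * exp (- (K * (L n * real n) + real n) / p) * exp (\<beta> * (real n powr (q - 1) * ?h)))"
      using c_p_pos[OF p(1)] by (simp add: ln_mult ln_realpow c_def minus_divide_left[symmetric] mult.left_commute[of \<beta>]
          del: minus_add_distrib)
    also have "\<dots> \<le> ln (Z_np n p \<beta>)" using Zlow Z(2) by (intro ln_mono) auto
    finally have "real n powr (1 - q) * (real n * c - (K * (L n * real n) + real n) / p + real n powr (q - 1) * (\<beta> * ?h))
        \<le> real n powr (1 - q) * ln (Z_np n p \<beta>)" by (intro mult_left_mono) auto
    moreover have "real n powr (1 - q) * (real n * c - (K * (L n * real n) + real n) / p + real n powr (q - 1) * (\<beta> * ?h))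
        = lower n"
      unfolding lower_def distrib_left[of "real n powr (1 - q)"] mult.assoc[of "real n powr (1 - q)", symmetric]
      using cancel by simp
    ultimately show ?thesis using up by simp
  qed
  \<comment> \<open>The mass contributes only at order \<open>n powr (2 - q)\<close>.\<close>
  have upper_lim: "upper \<longlonglongrightarrow> \<beta> / 2 * tau p"
    unfolding upper_def using q by real_asymp
  have lower_lim: "lower \<longlonglongrightarrow> \<beta> / 2 * tau p"
  proof -
    have "(\<lambda>n. L n / (K * L n + 1)) \<longlonglongrightarrow> inverse K"
      unfolding L_def using q K by real_asymp
    then have "(\<lambda>n. \<beta> * ((L n / (K * L n + 1)) powr q * (K * (K - 1) / 2)))
        \<longlonglongrightarrow> \<beta> * (inverse K powr q * (K * (K - 1) / 2))"
      using K by (intro tendsto_intros) auto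
    moreover have "(\<lambda>n. real n powr (1 - q) * (real n * c - (K * (L n * real n) + real n) / p)) \<longlonglongrightarrow> 0"
      unfolding L_def using q K p by real_asymp
    ultimately have "lower \<longlonglongrightarrow> \<beta> * (inverse K powr q * (K * (K - 1) / 2)) + 0"
      unfolding lower_def by (rule tendsto_add)
    also have "\<beta> * (inverse K powr q * (K * (K - 1) / 2)) + 0 = \<beta> / 2 * tau p"
    proof -
      have "tau p = K powr (1 - q) * (K - 1)"
        using k(2) by (simp only: plateau_def K_def q_def)
      also have "K powr (1 - q) = inverse K powr q * K"
        using K by (simp add: powr_diff inverse_powr divide_inverse mult.commute)
      finally show ?thesis by simp
    qed
    finally show ?thesis .
  qed
  have "(\<lambda>n. real n powr (1 - q) * ln (Z_np n p \<beta>)) \<longlonglongrightarrow> \<beta> / 2 * tau p"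
  proof (rule tendsto_sandwich[OF _ _ lower_lim upper_lim])
    show "\<forall>\<^sub>F n in sequentially. lower n \<le> real n powr (1 - q) * ln (Z_np n p \<beta>)"
      using eventually_ge_at_top[of k] by eventually_elim (rule bounds[THEN conjunct1])
    show "\<forall>\<^sub>F n in sequentially. real n powr (1 - q) * ln (Z_np n p \<beta>) \<le> upper n"
      using eventually_ge_at_top[of k] by eventually_elim (rule bounds[THEN conjunct2])
  qed
  then show ?thesis by (simp only: q_def)
qed

end
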